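(* For every integer $z > 1$, the sequence $\sigma_z = (\sigma_z(n))_{n=1}^{\infty}$, defined by $\sigma_z(n) := \tau_{z,n}$, is periodic.
   Context: For positive integers $m,n$, the discrete torus is $T_{m\times n} := \{0,\ldots,m-1\}\times\{0,\ldots,n-1\}\subset\mathbb{Z}^2$, and $\pi_{m,n}:\mathbb{Z}^2\to T_{m\times n}$ is the map $(x,y)\mapsto (x \bmod m,\ y \bmod n)$. A line in $\mathbb{Z}^2$ is a set $\ell_{\mathbb{R}^2}\cap\mathbb{Z}^2$, where $\ell_{\mathbb{R}^2}$ is a line in $\mathbb{R}^2$ containing at least two points with integer coordinates (equivalently, a set $\{A+k(u,v): k\in\mathbb{Z}\}$ with $A\in\mathbb{Z}^2$, $u,v \in \mathbb{Z}$, $\gcd(u,v)=1$). A line on $T_{m\times n}$ is the image under $\pi_{m,n}$ of a line in $\mathbb{Z}^2$. Points of $T_{m\times n}$ are collinear if some line on $T_{m\times n}$ contains all of them. $\tau_{m,n}$ denotes the maximal number of points that can be placed on $T_{m\times n}$ so that no three (distinct) of these points are collinear. A sequence $(s(n))_{n\ge 1}$ is periodic with period $T$ (a positive integer, not necessarily the least such) if $s(n+T)=s(n)$ for all $n\ge 1$; it is periodic if it is periodic with some period $T$. *)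

theory Defs
  imports "HOL-Analysis.Analysis"
begin

definition torus :: "nat \<Rightarrow> nat \<Rightarrow> (int \<times> int) set" where
  "torus m n = {0..<int m} \<times> {0..<int n}"

definition torus_proj :: "nat \<Rightarrow> nat \<Rightarrow> int \<times> int \<Rightarrow> int \<times> int" where
  "torus_proj m n = (\<lambda>(x, y). (x mod int m, y mod int n))"

definition real_point :: "int \<times> int \<Rightarrow> real \<times> real" where
  "real_point = (\<lambda>(x, y). (of_int x, of_int y))"

definition lattice_line :: "(int \<times> int) set \<Rightarrow> bool" where
  "lattice_line l \<longleftrightarrow>
     (\<exists>L. affine L \<and> aff_dim L = 1 \<and>
          (\<exists>P Q. P \<noteq> Q \<and> real_point P \<in> L \<and> real_point Q \<in> L) \<and>
          l = real_point -` L)"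

definition torus_line :: "nat \<Rightarrow> nat \<Rightarrow> (int \<times> int) set \<Rightarrow> bool" where
  "torus_line m n l \<longleftrightarrow> (\<exists>l'. lattice_line l' \<and> l = torus_proj m n ` l')"

definition torus_collinear :: "nat \<Rightarrow> nat \<Rightarrow> (int \<times> int) set \<Rightarrow> bool" where
  "torus_collinear m n S \<longleftrightarrow> (\<exists>l. torus_line m n l \<and> S \<subseteq> l)"

definition no_three_collinear :: "nat \<Rightarrow> nat \<Rightarrow> (int \<times> int) set \<Rightarrow> bool" where
  "no_three_collinear m n S \<longleftrightarrow>
     (\<forall>P\<in>S. \<forall>Q\<in>S. \<forall>R\<in>S. P \<noteq> Q \<and> Q \<noteq> R \<and> P \<noteq> R \<longrightarrow> \<not> torus_collinear m n {P, Q, R})"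

definition tau :: "nat \<Rightarrow> nat \<Rightarrow> nat" where
  "tau m n = Max {card S | S. S \<subseteq> torus m n \<and> no_three_collinear m n S}"

definition sigma_seq :: "nat \<Rightarrow> nat \<Rightarrow> nat" where
  "sigma_seq z n = tau z n"

(* Sequences are indexed from 1; the value at index 0 is irrelevant. *)
definition periodic_seq_with :: "nat \<Rightarrow> (nat \<Rightarrow> 'a) \<Rightarrow> bool" where
  "periodic_seq_with T s \<longleftrightarrow> T > 0 \<and> (\<forall>n\<ge>1. s (n + T) = s n)"

definition periodic_seq :: "(nat \<Rightarrow> 'a) \<Rightarrow> bool" where
  "periodic_seq s \<longleftrightarrow> (\<exists>T. periodic_seq_with T s)"

(* The maximum in the definition of tau is attained: the set is finite and nonempty. *)
lemma tau_set_finite_nonempty: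
  "finite {card S | S. S \<subseteq> torus m n \<and> no_three_collinear m n S}"
  "{card S | S. S \<subseteq> torus m n \<and> no_three_collinear m n S} \<noteq> {}"
proof -
  have "finite (torus m n)" by (simp add: torus_def)
  then have "finite (card ` Pow (torus m n))" by simp
  then show "finite {card S | S. S \<subseteq> torus m n \<and> no_three_collinear m n S}"
    by (rule rev_finite_subset) auto
  have "no_three_collinear m n {}" by (simp add: no_three_collinear_def)
  then show "{card S | S. S \<subseteq> torus m n \<and> no_three_collinear m n S} \<noteq> {}" by blast
qed

lemma real_point_vimage_line:
  fixes a b u v d :: int
  assumes "coprime u v" and "d \<noteq> 0"
  shows "real_point -` (affine hull {real_point (a, b), real_point (a + d * u, b + d * v)})
           = {(a + k * u, b + k * v) | k. True}" (is "?L = ?R")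
proof
  show "?L \<subseteq> ?R"
  proof
    fix X assume "X \<in> ?L"
    obtain x y where X: "X = (x, y)" by (cases X)
    from \<open>X \<in> ?L\<close> obtain t :: real where
      t: "of_int x = of_int a + t * (of_int d * of_int u)"
         "of_int y = of_int b + t * (of_int d * of_int v)"
      unfolding X real_point_def affine_hull_2_alt by auto
    have "real_of_int ((x - a) * v) = of_int ((y - b) * u)"
      using t by (simp add: algebra_simps)
    then have c: "(x - a) * v = (y - b) * u" by (simp only: of_int_eq_iff)
    from bezout_int[of u v] assms(1) obtain p q where pq: "p * u + q * v = 1" by auto
    define k where "k = (x - a) * p + (y - b) * q"
    have "k * u = (x - a) * (p * u) + ((y - b) * u) * q" by (simp add: k_def algebra_simps)
    also have "\<dots> = (x - a) * (p * u + q * v)" unfolding c[symmetric] by (simp add: algebra_simps)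
    finally have 1: "k * u = x - a" by (simp add: pq)
    have "k * v = ((x - a) * v) * p + (y - b) * (q * v)" by (simp add: k_def algebra_simps)
    also have "\<dots> = (y - b) * (p * u + q * v)" unfolding c by (simp add: algebra_simps)
    finally have 2: "k * v = y - b" by (simp add: pq)
    show "X \<in> ?R" using 1 2 X by (auto intro!: exI[of _ k])
  qed
next
  show "?R \<subseteq> ?L"
  proof
    fix X assume "X \<in> ?R"
    then obtain k where X: "X = (a + k * u, b + k * v)" by auto
    show "X \<in> ?L"
      unfolding X real_point_def affine_hull_2_alt
      using assms(2) by (auto intro!: image_eqI[of _ _ "of_int k / of_int d"])
  qed
qed

lemma real_point_eq_iff: "real_point P = real_point Q \<longleftrightarrow> P = Q"
  by (cases P; cases Q) (simp add: real_point_def)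

lemma lattice_line_iff:
  "lattice_line l \<longleftrightarrow>
     (\<exists>a b u v. coprime u v \<and> l = {(a + k * u, b + k * v) | k. True})"
proof
  assume "lattice_line l"
  then obtain L P Q where L: "affine L" "aff_dim L = 1" "P \<noteq> Q" "real_point P \<in> L"
    "real_point Q \<in> L" "l = real_point -` L"
    unfolding lattice_line_def by blast
  let ?H = "affine hull {real_point P, real_point Q}"
  have "?H \<subseteq> L" using L by (intro hull_minimal) auto
  moreover have "aff_dim ?H = 1" using L by (simp add: aff_dim_affine_hull aff_dim_2 real_point_eq_iff)
  ultimately have "?H = L"
    using L by (intro affine_dim_equal) (auto simp: aff_dim_affine_hull)
  obtain a b c e where PQ: "P = (a, b)" "Q = (c, e)" by (cases P, cases Q)
  define d where "d = gcd (c - a) (e - b)"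
  have d: "d \<noteq> 0" using L(3) by (auto simp: d_def PQ)
  obtain u v where uv: "c - a = u * d" "e - b = v * d" "coprime u v"
    using gcd_coprime_exists[of "c - a" "e - b"] d unfolding d_def by blast
  have "Q = (a + d * u, b + d * v)" using uv by (simp add: PQ algebra_simps)
  then have "l = {(a + k * u, b + k * v) | k. True}"
    using real_point_vimage_line[OF uv(3) d, of a b] \<open>?H = L\<close> L(6) PQ by simp
  then show "\<exists>a b u v. coprime u v \<and> l = {(a + k * u, b + k * v) | k. True}"
    using uv(3) by blast
next
  assume "\<exists>a b u v. coprime u v \<and> l = {(a + k * u, b + k * v) | k. True}"
  then obtain a b u v where uv: "coprime u v" "l = {(a + k * u, b + k * v) | k. True}" by blast
  define P Q where "P = (a, b)" and "Q = (a + u, b + v)"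
  have ne: "P \<noteq> Q" using uv(1) by (auto simp: P_def Q_def)
  let ?H = "affine hull {real_point P, real_point Q}"
  have "aff_dim ?H = 1" using ne by (simp add: aff_dim_affine_hull aff_dim_2 real_point_eq_iff)
  moreover have "l = real_point -` ?H"
    using real_point_vimage_line[OF uv(1), of 1 a b] uv(2) by (simp add: P_def Q_def)
  moreover have "affine ?H" "real_point P \<in> ?H" "real_point Q \<in> ?H"
    by (simp_all add: hull_inc)
  ultimately show "lattice_line l"
    unfolding lattice_line_def using ne by blast
qed

end

theory Submission
  imports Defs "HOL-Number_Theory.Number_Theory"
begin

text \<open>
  For fixed \<open>z\<close>, the function \<open>n \<mapsto> \<tau>\<^sub>z\<^sub>,\<^sub>n\<close> is monotone with respect to divisibility (a line on the
  larger torus projects into a line on the smaller one), it is bounded by \<open>2 z\<close> (the torus is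
  covered by \<open>z\<close> vertical lines), and by the Chinese remainder theorem it is insensitive to factors
  of \<open>n\<close> that are coprime to \<open>z\<close>. A bounded function that is monotone in each of the finitely many
  exponents of the primes dividing \<open>z\<close> becomes constant once an exponent is large
  enough, so \<open>\<tau>\<^sub>z\<^sub>,\<^sub>n\<close> depends only on \<open>gcd n T\<close> for some \<open>T > 0\<close>, and this \<open>T\<close> is a period.
\<close>

section \<open>Bounded functions that are monotone with respect to divisibility\<close>

text \<open>Induction over the primes, for all \<open>f\<close> at once. Write
  \<open>n = p ^ a * m\<close>. For each fixed \<open>a\<close> the hypothesis applies to
  \<open>f (p ^ a * m)\<close> as a function of \<open>m\<close>, and it also applies to the limit
  as \<open>a\<close> grows. One threshold \<open>N\<close> makes the limit attained wherever it is
  needed, so only the finitely many \<open>a < N\<close> need moduli of their own.\<close>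

lemma bounded_dvd_mono_eq_gcd:
  fixes f :: "nat \<Rightarrow> nat"
  assumes "finite A" and "\<And>p. p \<in> A \<Longrightarrow> prime p"
    and "\<And>m n. m dvd n \<Longrightarrow> n > 0 \<Longrightarrow> f m \<le> f n"
    and "\<And>n. n > 0 \<Longrightarrow> f n \<le> B"
  shows "\<exists>T>0. \<forall>n>0. prime_factors n \<subseteq> A \<longrightarrow> f n = f (gcd n T)"
  using assms
proof (induction A arbitrary: f rule: finite_induct)
  case empty
  have "n = 1" if "n > 0" "prime_factors n \<subseteq> {}" for n :: nat
    using that by (simp add: prime_factorization_empty_iff)
  then show ?case by (intro exI[of _ 1]) auto
next
  case (insert p A)
  have p: "prime p" and p0: "p > 0" using insert.prems(1) prime_gt_0_nat by auto
  note mono = insert.prems(2) and bnd = insert.prems(3)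
  have "\<exists>T>0. \<forall>m>0. prime_factors m \<subseteq> A \<longrightarrow> f (p ^ a * m) = f (p ^ a * gcd m T)" for a
    by (rule insert.IH) (use insert.prems p0 in auto)
  then obtain T where T: "\<And>a. T a > 0"
    "\<And>a m. m > 0 \<Longrightarrow> prime_factors m \<subseteq> A \<Longrightarrow> f (p ^ a * m) = f (p ^ a * gcd m (T a))"
    by metis
  \<comment> \<open>By monotonicity and boundedness, for \<open>m > 0\<close> this is the eventual
    value of \<open>f (p ^ a * m)\<close> as \<open>a\<close> grows.\<close>
  define F where "F m = Max (range (\<lambda>a. f (p ^ a * m)))" for m
  have fin: "finite (range (\<lambda>a. f (p ^ a * m)))" for m
  proof (rule finite_subset)
    \<comment> \<open>The bound \<open>B\<close> covers positive arguments only, so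
      \<open>f 0\<close> enters separately for \<open>m = 0\<close>.\<close>
    show "range (\<lambda>a. f (p ^ a * m)) \<subseteq> {..max B (f 0)}"
      using bnd p0 by (cases "m = 0") (auto simp: le_max_iff_disj)
  qed simp
  have F_ge: "f (p ^ a * m) \<le> F m" for a m
    unfolding F_def by (intro Max_ge fin) auto
  have F_att: "\<exists>a. F m = f (p ^ a * m)" for m
    using Max_in[OF fin, of m] unfolding F_def by auto
  have "\<exists>T>0. \<forall>m>0. prime_factors m \<subseteq> A \<longrightarrow> F m = F (gcd m T)"
  proof (rule insert.IH)
    show "F m \<le> F n" if mn: "m dvd n" "n > 0" for m n
    proof -
      obtain a where "F m = f (p ^ a * m)" using F_att by blast
      also have "\<dots> \<le> f (p ^ a * n)" using mn p0 by (intro mono) auto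
      finally show ?thesis using F_ge[of a n] by simp
    qed
    show "F n \<le> B" if "n > 0" for n
      using F_att[of n] bnd that p0 by auto
  qed (use insert.prems in auto)
  then obtain U where U: "U > 0"
    "\<And>m. m > 0 \<Longrightarrow> prime_factors m \<subseteq> A \<Longrightarrow> F m = F (gcd m U)" by blast
  obtain e where e: "\<And>m. F m = f (p ^ e m * m)" using F_att by metis
  \<comment> \<open>\<open>U\<close> has finitely many divisors, so one exponent attains the limit
    at all of them.\<close>
  define N where "N = Max (e ` {d. d dvd U})"
  have N: "F d = f (p ^ N * d)" if "d dvd U" for d
  proof (rule antisym)
    have "e d \<le> N" unfolding N_def using that U(1) by (intro Max_ge) auto
    then have "p ^ e d * d dvd p ^ N * d" by (simp add: le_imp_power_dvd)
    moreover have "d > 0" using that U(1) by (auto intro!: Nat.gr0I)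
    ultimately show "F d \<le> f (p ^ N * d)" using e p0 by (auto intro!: mono)
  qed (rule F_ge)
  \<comment> \<open>The factor \<open>p ^ N * U\<close> serves exponents of \<open>p\<close> from
    \<open>N\<close> on, the product serves those below \<open>N\<close>.\<close>
  define V where "V = p ^ N * (U * (\<Prod>a<N. T a))"
  have "V > 0" unfolding V_def using p0 U(1) T(1) by (auto intro!: prod_pos)
  moreover have "f n = f (gcd n V)" if n: "n > 0" "prime_factors n \<subseteq> insert p A" for n
  proof (rule antisym)
    show "f (gcd n V) \<le> f n" using n by (intro mono) auto
    obtain m where m: "n = p ^ multiplicity p n * m" "\<not> p dvd m"
      using multiplicity_decompose'[of n p] n(1) p not_prime_unit by blast
    define a where "a = multiplicity p n"
    have na: "n = p ^ a * m" using m a_def by simp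
    have m0: "m > 0" using m(2) by (auto intro!: Nat.gr0I)
    have mA: "prime_factors m \<subseteq> A"
      using n m(2) dvd_prime_factors[of n m] na by (auto simp: in_prime_factors_iff)
    have gV: "gcd n V > 0" using n by simp
    show "f n \<le> f (gcd n V)"
    proof (cases "a < N")
      case True
      have "p ^ a dvd p ^ N" using True by (simp add: le_imp_power_dvd)
      moreover have "gcd m (T a) dvd (\<Prod>a<N. T a)"
        using True by (intro dvd_trans[OF gcd_dvd2] dvd_prodI) auto
      ultimately have "p ^ a * gcd m (T a) dvd gcd n V"
        unfolding na V_def by (intro gcd_greatest mult_dvd_mono) auto
      then show ?thesis using T(2)[OF m0 mA, of a] mono[OF _ gV] na by metis
    next
      case False
      then have "p ^ N dvd p ^ a" by (simp add: le_imp_power_dvd)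
      then have "p ^ N * gcd m U dvd gcd n V"
        unfolding na V_def by (intro gcd_greatest mult_dvd_mono) auto
      then have "f (p ^ N * gcd m U) \<le> f (gcd n V)" by (rule mono[OF _ gV])
      moreover have "f n \<le> F m" unfolding na by (rule F_ge)
      ultimately show ?thesis using U(2)[OF m0 mA] N[of "gcd m U"] by simp
    qed
  qed
  ultimately show ?case by blast
qed

section \<open>Number-theoretic preliminaries\<close>

text \<open>Common primes of \<open>n\<close> and \<open>z\<close> are moved into \<open>s\<close>
  one at a time until the rest is coprime to \<open>z\<close>.\<close>

lemma smooth_times_coprime:
  fixes z n :: nat
  assumes "z > 0" "n > 0"
  shows "\<exists>s q. n = s * q \<and> s > 0 \<and> prime_factors s \<subseteq> prime_factors z \<and> coprime q z"
  using assms(2)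
proof (induction n rule: less_induct)
  case (less n)
  show ?case
  proof (cases "coprime n z")
    case True
    then show ?thesis by (intro exI[of _ 1] exI[of _ n]) auto
  next
    case False
    obtain p where p: "prime p" "p dvd n" "p dvd z"
      using False by (meson coprime_iff_gcd_eq_1 gcd_nat.bounded_iff prime_factor_nat)
    then obtain k where k: "n = p * k" by auto
    then have "k < n" "k > 0" using less.prems p(1) prime_gt_1_nat by auto
    then obtain s q where "k = s * q" "s > 0" "prime_factors s \<subseteq> prime_factors z" "coprime q z"
      using less.IH by blast
    then show ?thesis using p assms(1) k
      by (intro exI[of _ "p * s"] exI[of _ q])
        (auto simp: prime_factors_product prime_prime_factors in_prime_factors_iff prime_gt_0_nat)
  qed
qed

text \<open>Induction over the prime factors of the modulus. If a new prime \<open>p\<close> divides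
  \<open>a + b * w\<close>, it divides neither \<open>b\<close> nor \<open>q\<close>. Shifting
  \<open>w\<close> by \<open>q\<close> then removes \<open>p\<close> from the value without changing
  its residue modulo \<open>q\<close>.\<close>

lemma ex_coprime_in_progression:
  fixes a b :: int and q :: nat
  assumes "coprime a b" and "q > 0"
  shows "\<exists>w. coprime (a + b * w) (int q)"
  using assms(2)
proof (induction q rule: prime_divisors_induct)
  case zero
  then show ?case by simp
next
  case (unit q)
  then show ?case by auto
next
  case (factor p q)
  then obtain w where w: "coprime (a + b * w) (int q)" by auto
  have p: "prime (int p)" using factor.hyps by simp
  show ?case
  proof (cases "int p dvd a + b * w")
    case False
    then have "coprime (int p) (a + b * w)" using p by (rule prime_imp_coprime[rotated])
    then show ?thesis using w by (auto intro!: exI[of _ w] simp: coprime_commute)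
  next
    case True
    have "\<not> int p dvd b"
    proof
      assume "int p dvd b"
      moreover from this True have "int p dvd a" by (simp add: dvd_add_left_iff)
      ultimately show False using assms(1) p not_prime_unit coprime_common_divisor by blast
    qed
    moreover have "\<not> int p dvd int q"
      using True w p not_prime_unit coprime_common_divisor by blast
    ultimately have "\<not> int p dvd b * int q" using p by (simp add: prime_dvd_mult_iff)
    then have "\<not> int p dvd (a + b * w) + b * int q" using True by (simp add: dvd_add_right_iff)
    then have "coprime (int p) (a + b * (w + int q))"
      using p by (simp add: prime_imp_coprime algebra_simps)
    moreover have "[a + b * w = a + b * (w + int q)] (mod int q)"
      by (simp add: cong_iff_dvd_diff algebra_simps)
    then have "coprime (a + b * (w + int q)) (int q)"
      using w by (rule cong_imp_coprime)
    ultimately show ?thesis by (auto intro!: exI[of _ "w + int q"] simp: coprime_commute)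
  qed
qed

section \<open>Collinearity as a system of congruences\<close>

text \<open>Taking \<open>P\<close> as base point leaves only differences, so representatives
  outside the torus are allowed as well.\<close>

definition cong_collinear :: "nat \<Rightarrow> nat \<Rightarrow> int \<times> int \<Rightarrow> int \<times> int \<Rightarrow> int \<times> int \<Rightarrow> bool" where
  "cong_collinear m n P Q R \<longleftrightarrow> (\<exists>u v k l. coprime u v \<and>
     [fst Q - fst P = k * u] (mod int m) \<and> [snd Q - snd P = k * v] (mod int n) \<and>
     [fst R - fst P = l * u] (mod int m) \<and> [snd R - snd P = l * v] (mod int n))"

lemma torus_collinear_iff:
  assumes "P \<in> torus m n" "Q \<in> torus m n" "R \<in> torus m n"
  shows "torus_collinear m n {P, Q, R} \<longleftrightarrow> cong_collinear m n P Q R"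
proof
  assume "torus_collinear m n {P, Q, R}"
  then obtain a b u v where uv: "coprime u v"
    "{P, Q, R} \<subseteq> torus_proj m n ` {(a + k * u, b + k * v) | k. True}"
    unfolding torus_collinear_def torus_line_def lattice_line_iff by blast
  have on_line: "\<exists>i. X = torus_proj m n (a + i * u, b + i * v)" if "X \<in> {P, Q, R}" for X
    using uv(2) that by auto
  obtain i j k where
    "P = torus_proj m n (a + i * u, b + i * v)"
    "Q = torus_proj m n (a + j * u, b + j * v)"
    "R = torus_proj m n (a + k * u, b + k * v)"
    using on_line[of P] on_line[of Q] on_line[of R] by (meson insertI1 insertI2)
  moreover have "[fst (torus_proj m n (x', y')) - fst (torus_proj m n (x, y)) = x' - x] (mod int m)"
    "[snd (torus_proj m n (x', y')) - snd (torus_proj m n (x, y)) = y' - y] (mod int n)" for x y x' y'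
    unfolding torus_proj_def by (auto intro!: cong_diff)
  moreover have "a + j * u - (a + i * u) = (j - i) * u" for a i j u :: int
    by (simp add: algebra_simps)
  ultimately show "cong_collinear m n P Q R"
    unfolding cong_collinear_def using uv(1) by metis
next
  assume "cong_collinear m n P Q R"
  then obtain u v k l where uv: "coprime u v"
     "[fst Q - fst P = k * u] (mod int m)" "[snd Q - snd P = k * v] (mod int n)"
     "[fst R - fst P = l * u] (mod int m)" "[snd R - snd P = l * v] (mod int n)"
    unfolding cong_collinear_def by blast
  have on_line: "X \<in> torus_proj m n ` {(fst P + k * u, snd P + k * v) | k. True}"
    if "X \<in> torus m n" "[fst X - fst P = i * u] (mod int m)" "[snd X - snd P = i * v] (mod int n)"
    for X i
  proof -
    have "[fst X = fst P + i * u] (mod int m)" "[snd X = snd P + i * v] (mod int n)"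
      using cong_add_lcancel[of "fst P"] that(2) cong_add_lcancel[of "snd P"] that(3)
      by (metis add_diff_cancel_left' add_diff_eq)+
    then have "X = torus_proj m n (fst P + i * u, snd P + i * v)" using that(1)
      by (cases X) (auto simp: torus_def torus_proj_def cong_def)
    then show ?thesis by blast
  qed
  have "lattice_line {(fst P + k * u, snd P + k * v) | k. True}"
    unfolding lattice_line_iff using uv(1) by blast
  moreover have "{P, Q, R} \<subseteq> torus_proj m n ` {(fst P + k * u, snd P + k * v) | k. True}"
    using on_line[of P 0] on_line[of Q k] on_line[of R l] assms uv by auto
  ultimately show "torus_collinear m n {P, Q, R}"
    unfolding torus_collinear_def torus_line_def by blast
qed

lemma no_three_collinear_iff:
  assumes "S \<subseteq> torus m n"
  shows "no_three_collinear m n S \<longleftrightarrow>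
    (\<forall>P\<in>S. \<forall>Q\<in>S. \<forall>R\<in>S. P \<noteq> Q \<and> Q \<noteq> R \<and> P \<noteq> R \<longrightarrow> \<not> cong_collinear m n P Q R)"
  unfolding no_three_collinear_def
  by (intro ball_cong refl) (use torus_collinear_iff assms in blast)

lemma cong_collinear_dvd:
  assumes "cong_collinear m n P Q R" "n' dvd n"
  shows "cong_collinear m n' P Q R"
  using assms(1) cong_dvd_modulus[of _ _ "int n" "int n'"] assms(2)
  unfolding cong_collinear_def by fastforce

lemma cong_collinear_cong:
  assumes "cong_collinear m n P' Q' R'"
    and "fst P' = fst P" "fst Q' = fst Q" "fst R' = fst R"
    and "[snd P' = snd P] (mod int n)" "[snd Q' = snd Q] (mod int n)" "[snd R' = snd R] (mod int n)"
  shows "cong_collinear m n P Q R"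
proof -
  have diff: "[snd X - snd P = snd X' - snd P'] (mod int n)"
    if "[snd X' = snd X] (mod int n)" for X X'
    using cong_diff[OF that assms(5)] by (rule cong_sym)
  obtain u v k l where "coprime u v"
     "[fst Q' - fst P' = k * u] (mod int m)" "[snd Q' - snd P' = k * v] (mod int n)"
     "[fst R' - fst P' = l * u] (mod int m)" "[snd R' - snd P' = l * v] (mod int n)"
    using assms(1) unfolding cong_collinear_def by blast
  then show ?thesis
    unfolding cong_collinear_def
    using assms(2-4) cong_trans[OF diff[OF assms(6)]] cong_trans[OF diff[OF assms(7)]]
    by (intro exI[of _ u] exI[of _ v] exI[of _ k] exI[of _ l]) auto
qed

lemma coprime_direction_exists:
  fixes x y :: int
  obtains u v l where "coprime u v" "x = l * u" "y = l * v"
proof (cases "gcd x y = 0")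
  case True
  \<comment> \<open>The zero vector has no direction of its own; any primitive one works with
    \<open>l = 0\<close>.\<close>
  then show ?thesis using that[of 1 0 0] by simp
next
  case False
  then show ?thesis using gcd_coprime_exists[of x y] that by (metis mult.commute)
qed

lemma cong_collinear_refl: "cong_collinear m n P P R"
proof -
  obtain u v l where "coprime u v" "fst R - fst P = l * u" "snd R - snd P = l * v"
    using coprime_direction_exists .
  then show ?thesis unfolding cong_collinear_def
    by (intro exI[of _ u] exI[of _ v] exI[of _ 0] exI[of _ l]) auto
qed

text \<open>The extra modulus \<open>q\<close> imposes no condition: the direction can be changed
  modulo \<open>q\<close> alone, and by the Chinese remainder theorem so can the parameters
  \<open>k\<close> and \<open>l\<close>. Coprimality to \<open>m\<close> keeps the first coordinates
  intact.\<close>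

lemma cong_collinear_mult_coprime:
  assumes "cong_collinear m n P Q R" and "coprime q (m * n)" and "q > 0"
  shows "cong_collinear m (n * q) P Q R"
proof -
  obtain u v k l where uv: "coprime u v"
     "[fst Q - fst P = k * u] (mod int m)" "[snd Q - snd P = k * v] (mod int n)"
     "[fst R - fst P = l * u] (mod int m)" "[snd R - snd P = l * v] (mod int n)"
    using assms(1) unfolding cong_collinear_def by blast
  have cop: "coprime (int q) (int m * int n)" "coprime (int n) (int q)" "coprime (int m) (int q)"
    using assms(2) by (auto simp: coprime_commute)
  \<comment> \<open>Adding a multiple of \<open>u n\<close> to \<open>v\<close> keeps the direction primitive and unchanged modulo \<open>n\<close>.
      Once the second coordinate is a unit modulo \<open>q\<close>, its multiples reach every residue there.\<close>
  have "\<exists>w. coprime (v + u * int n * w) (int q)"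
  proof -
    obtain w where "coprime (v + u * w) (int q)"
      using ex_coprime_in_progression[of v u q] uv(1) assms(3) by (auto simp: coprime_commute)
    moreover obtain w' where w': "[w' = 0] (mod int n)" "[w' = w] (mod int q)"
      using binary_chinese_remainder_int[OF cop(2)] by blast
    moreover have "[v + u * w' = v + u * w] (mod int q)"
      using w'(2) by (intro cong_add cong_mult) auto
    ultimately have "coprime (v + u * w') (int q)" using cong_imp_coprime cong_sym by blast
    moreover obtain t where "w' = int n * t" using w'(1) by (auto simp: cong_0_iff)
    ultimately show ?thesis by (auto simp: mult.assoc)
  qed
  then obtain w where w: "coprime (v + u * int n * w) (int q)" by blast
  define v' where "v' = v + u * int n * w"
  have "coprime u v'"
    using uv(1) unfolding v'_def
    by (metis coprime_iff_gcd_eq_1 gcd_add_mult mult.assoc mult.commute add.commute)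
  have vv': "[v' = v] (mod int n)" unfolding v'_def by (simp add: cong_iff_dvd_diff)
  have lift: "\<exists>k'. [x = k' * u] (mod int m) \<and> [y = k' * v'] (mod int (n * q))"
    if xy: "[x = k * u] (mod int m)" "[y = k * v] (mod int n)" for x y k
  proof -
    obtain i where i: "[v' * i = 1] (mod int q)"
      using cong_solve_coprime_int w unfolding v'_def by blast
    \<comment> \<open>Agreement modulo \<open>m * n\<close> preserves the old congruences; modulo
      \<open>q\<close>, the inverse \<open>i\<close> of \<open>v'\<close> yields
      \<open>k' * v' = y\<close>.\<close>
    obtain k' where k': "[k' = k] (mod int m * int n)" "[k' = y * i] (mod int q)"
      using binary_chinese_remainder_int[of "int m * int n" "int q"] cop(1)
      by (metis coprime_commute)
    have "[k' = k] (mod int m)" "[k' = k] (mod int n)"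
      using k'(1) cong_dvd_modulus by (meson dvd_triv_left dvd_triv_right)+
    then have "[k' * u = k * u] (mod int m)" "[k' * v' = k * v] (mod int n)"
      using vv' by (auto intro: cong_mult)
    moreover have "[k' * v' = y * i * v'] (mod int q)" using k'(2) by (auto intro: cong_mult)
    moreover have "[y * i * v' = y] (mod int q)"
      using cong_mult[OF cong_refl i, of y] by (simp add: ac_simps)
    ultimately have "[x = k' * u] (mod int m)" "[y = k' * v'] (mod int n)"
      "[y = k' * v'] (mod int q)"
      using xy by (meson cong_trans cong_sym)+
    then have "[y = k' * v'] (mod int (n * q))"
      using coprime_cong_mult cop(2) by (metis of_nat_mult)
    then show ?thesis using \<open>[x = k' * u] (mod int m)\<close> by blast
  qed
  show ?thesis
    unfolding cong_collinear_def using lift[OF uv(2,3)] lift[OF uv(4,5)] \<open>coprime u v'\<close> by blast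
qed

section \<open>Properties of \<open>\<tau>\<close>\<close>

lemma tau_ge:
  assumes "S \<subseteq> torus m n" "no_three_collinear m n S"
  shows "card S \<le> tau m n"
  unfolding tau_def using assms by (intro Max_ge tau_set_finite_nonempty) auto

lemma tau_attained:
  obtains S where "S \<subseteq> torus m n" "no_three_collinear m n S" "card S = tau m n"
  using Max_in[OF tau_set_finite_nonempty[of m n]] unfolding tau_def by auto

lemma finite_torus: "finite (torus m n)"
  by (simp add: torus_def)

text \<open>An optimal set for \<open>n\<close> remains admissible inside the larger torus, since
  collinearity modulo \<open>n'\<close> descends to \<open>n\<close>.\<close>

lemma tau_dvd_mono:
  assumes "n dvd n'" "n' > 0"
  shows "tau m n \<le> tau m n'"
proof -
  obtain S where S: "S \<subseteq> torus m n" "no_three_collinear m n S" "card S = tau m n"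
    by (rule tau_attained)
  have "n \<le> n'" using assms by (rule dvd_imp_le)
  then have sub: "S \<subseteq> torus m n'" using S(1) by (auto simp: torus_def)
  have "no_three_collinear m n' S"
    using S(2) assms(1) cong_collinear_dvd
    unfolding no_three_collinear_iff[OF S(1)] no_three_collinear_iff[OF sub] by meson
  then show ?thesis using tau_ge[OF sub] S(3) by simp
qed

lemma tau_le: "tau m n \<le> 2 * m"
proof -
  obtain S where S: "S \<subseteq> torus m n" "no_three_collinear m n S" "card S = tau m n"
    by (rule tau_attained)
  have fin: "finite S" using S(1) finite_torus finite_subset by blast
  have col: "card {P \<in> S. fst P = x} \<le> 2" for x
  proof (rule ccontr)
    assume "\<not> ?thesis"
    then obtain C where "C \<subseteq> {P \<in> S. fst P = x}" "card C = 3"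
      using obtain_subset_with_card_n[of 3 "{P \<in> S. fst P = x}"] by auto
    then obtain P Q R where PQR: "P \<in> S" "Q \<in> S" "R \<in> S" "fst P = x" "fst Q = x" "fst R = x"
      "P \<noteq> Q" "Q \<noteq> R" "P \<noteq> R"
      by (auto simp: card_3_iff)
    \<comment> \<open>Points of one column lie on a line with direction
      \<open>(0, 1)\<close>.\<close>
    have "cong_collinear m n P Q R"
      unfolding cong_collinear_def using PQR
      by (intro exI[of _ 0] exI[of _ 1] exI[of _ "snd Q - snd P"] exI[of _ "snd R - snd P"]) auto
    then show False using S(2) PQR unfolding no_three_collinear_iff[OF S(1)] by blast
  qed
  have "S = (\<Union>x\<in>{0..<int m}. {P \<in> S. fst P = x})" using S(1) by (auto simp: torus_def)
  then have "card S = card (\<Union>x\<in>{0..<int m}. {P \<in> S. fst P = x})" by (rule arg_cong)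
  also have "\<dots> \<le> (\<Sum>x\<in>{0..<int m}. card {P \<in> S. fst P = x})" by (rule card_UN_le) simp
  also have "\<dots> \<le> (\<Sum>x\<in>{0..<int m}. 2)" by (intro sum_mono col)
  finally show ?thesis using S(3) by simp
qed

lemma tau_ge_2:
  assumes "m > 1" "n > 0"
  shows "tau m n \<ge> 2"
proof -
  have "card {(0::int, 0::int), (1, 0)} \<le> tau m n"
    using assms by (intro tau_ge) (auto simp: torus_def no_three_collinear_def)
  then show ?thesis by simp
qed

text \<open>Reducing second coordinates modulo \<open>n\<close> creates no new collinear triples,
  because collinearity lifts back to \<open>n * q\<close>.\<close>

lemma tau_mult_coprime:
  assumes "m > 1" "n > 0" "q > 0" "coprime q (m * n)"
  shows "tau m (n * q) = tau m n"
proof (rule antisym)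
  show "tau m n \<le> tau m (n * q)" using assms by (intro tau_dvd_mono) auto
  obtain S where S: "S \<subseteq> torus m (n * q)" "no_three_collinear m (n * q) S" "card S = tau m (n * q)"
    by (rule tau_attained)
  show "tau m (n * q) \<le> tau m n"
  proof (cases "card S \<le> 2")
    \<comment> \<open>Such a set has no third point to force injectivity of the reduction, so the
      bound \<open>tau_ge_2\<close> takes over.\<close>
    case True
    then show ?thesis using tau_ge_2[OF assms(1,2)] S(3) by simp
  next
    case False
    define h :: "int \<times> int \<Rightarrow> int \<times> int" where "h = (\<lambda>(x, y). (x, y mod int n))"
    have fst_h: "fst (h P) = fst P" and snd_h: "[snd (h P) = snd P] (mod int n)" for P
      by (auto simp: h_def cong_def split: prod.splits)
    have col: "cong_collinear m (n * q) P Q R" if "cong_collinear m n (h P) (h Q) (h R)" for P Q R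
      using cong_collinear_cong[OF that] fst_h snd_h cong_collinear_mult_coprime assms by blast
    have inj: "inj_on h S"
    proof (rule inj_onI, rule ccontr)
      fix P Q assume PQ: "P \<in> S" "Q \<in> S" "h P = h Q" "P \<noteq> Q"
      have "\<not> S \<subseteq> {P, Q}"
        using False card_mono[of "{P, Q}" S] PQ(4) by auto
      then obtain R where R: "R \<in> S" "R \<noteq> P" "R \<noteq> Q" by blast
      \<comment> \<open>If \<open>P\<close> and \<open>Q\<close> merged, their common image would be
        collinear with that of any third point.\<close>
      have "cong_collinear m n (h P) (h Q) (h R)" unfolding PQ(3) by (rule cong_collinear_refl)
      then show False using col S(2) PQ R unfolding no_three_collinear_iff[OF S(1)] by metis
    qed
    have sub: "h ` S \<subseteq> torus m n" using S(1) assms(2) by (auto simp: h_def torus_def)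
    have "no_three_collinear m n (h ` S)"
      unfolding no_three_collinear_iff[OF sub]
      using S(2) col unfolding no_three_collinear_iff[OF S(1)] by (auto; metis)
    then show ?thesis using tau_ge[OF sub] card_image[OF inj] S(3) by simp
  qed
qed

lemma tau_eq_gcd:
  assumes "m > 1"
  obtains T where "T > 0" "\<And>n. n > 0 \<Longrightarrow> tau m n = tau m (gcd n T)"
proof -
  have "\<exists>T>0. \<forall>n>0. prime_factors n \<subseteq> prime_factors m \<longrightarrow> tau m n = tau m (gcd n T)"
    by (rule bounded_dvd_mono_eq_gcd[of _ _ "2 * m"])
      (auto simp: tau_le tau_dvd_mono in_prime_factors_iff)
  then obtain T where T: "T > 0"
    "\<And>n. n > 0 \<Longrightarrow> prime_factors n \<subseteq> prime_factors m \<Longrightarrow> tau m n = tau m (gcd n T)" by blast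
  have "tau m n = tau m (gcd n T)" if "n > 0" for n
  proof (rule antisym)
    obtain s q where sq: "n = s * q" "s > 0" "prime_factors s \<subseteq> prime_factors m" "coprime q m"
      using smooth_times_coprime[of m n] \<open>n > 0\<close> assms
      by (metis less_trans zero_less_one)
    \<comment> \<open>Every prime of \<open>s\<close> divides \<open>m\<close>, which is coprime to
      \<open>q\<close>.\<close>
    have "coprime q s"
    proof (rule ccontr)
      assume "\<not> coprime q s"
      then obtain p where p: "prime p" "p dvd q" "p dvd s"
        by (meson coprime_iff_gcd_eq_1 gcd_nat.bounded_iff prime_factor_nat)
      then have "p dvd m" using sq(2,3) by (auto simp: in_prime_factors_iff)
      then show False using sq(4) p coprime_common_divisor not_prime_unit by blast
    qed
    then have "tau m n = tau m s"
      using tau_mult_coprime[of m s q] assms sq that by simp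
    also have "\<dots> = tau m (gcd s T)" using T(2) sq by blast
    also have "\<dots> \<le> tau m (gcd n T)" using that sq(1) by (intro tau_dvd_mono gcd_mono) auto
    finally show "tau m n \<le> tau m (gcd n T)" .
    show "tau m (gcd n T) \<le> tau m n" using that by (intro tau_dvd_mono) auto
  qed
  then show ?thesis using that T(1) by blast
qed

theorem theorem2:
  fixes z :: nat
  assumes "z > 1"
  shows "periodic_seq (sigma_seq z)"
proof -
  obtain T where T: "T > 0" "\<And>n. n > 0 \<Longrightarrow> tau z n = tau z (gcd n T)"
    using tau_eq_gcd[OF assms] by blast
  \<comment> \<open>Adding \<open>T\<close> to \<open>n\<close> does not change the gcd with
    \<open>T\<close>.\<close>
  have "tau z (n + T) = tau z n" if "n \<ge> 1" for n
    using T(2)[of n] T(2)[of "n + T"] that by simp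
  then have "periodic_seq_with T (sigma_seq z)"
    unfolding periodic_seq_with_def sigma_seq_def using T(1) by blast
  then show ?thesis unfolding periodic_seq_def by blast
qed

end
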